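(* Let $\mathcal X$ be a normed vector space, $\mathcal D$ a subset of $\mathcal X$, and $W:\mathcal D\to\mathbb R$ a functional such that: (1) there exists $\gamma\ge0$ such that $W(x)\ge-\gamma$ for every $x\in\mathcal D$; (2) every $W$-bounded sequence in $\mathcal D$ contains a subsequence converging weakly to an element of $\mathcal D$. Let $J,J_n:\mathcal D\to\mathbb R$, $n=1,2,\dots$, be functionals such that $J$ is $W$-subsequentially weakly lower semicontinuous and the sequence $\{J_n\}$ is $W$-coercive and $W$-uniformly consistent for $J$. Assume further that $J$ has a unique global minimizer $\bar x\in\mathcal D$ and that each functional $J_n$ possesses a global minimizer $x_n$ on $\mathcal D$ (not necessarily unique). Then $x_n$ converges weakly to $\bar x$.
   Context: A sequence or subset of $\mathcal D$ is $W$-bounded if there is a constant $k<\infty$ with $|W(x)|\le k$ for all its elements $x$. $J$ is $W$-subsequentially weakly lower semicontinuous if for every $W$-bounded sequence $\{x_n\}\subset\mathcal D$ converging weakly to some $x\in\mathcal D$ there is a subsequence $\{x_{n_j}\}$ with $J(x)\le\liminf_{j\to\infty}J(x_{n_j})$. The sequence $\{J_n\}$ is $W$-coercive if $\lim_{n\to\infty}J_n(x_n)=+\infty$ for every sequence $\{x_n\}\subset\mathcal D$ with $\lim_{n\to\infty}W(x_n)=+\infty$. The sequence $\{J_n\}$ is $W$-uniformly consistent for $J$ if for any $c>0$ and $\epsilon>0$ there exists $N=N(c,\epsilon)$ such that $|J_n(x)-J(x)|<\epsilon$ for every $n\ge N$ and every $x\in\mathcal D$ with $|W(x)|\le c$.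 *)

theory Defs
  imports Complex_Main "HOL-Library.Extended_Real"
begin

text \<open>
  A functional on a subset \<open>D\<close> of a normed space is represented by a total function whose
  values outside \<open>D\<close> are never used. Sequences are indexed from 0.
\<close>

definition weakly_converges :: "(nat \<Rightarrow> 'a::real_normed_vector) \<Rightarrow> 'a \<Rightarrow> bool"
  where "weakly_converges x l \<longleftrightarrow>
    (\<forall>f :: 'a \<Rightarrow> real. bounded_linear f \<longrightarrow> (\<lambda>n. f (x n)) \<longlonglongrightarrow> f l)"

text \<open>A sequence \<open>x\<close> is \<open>W\<close>-bounded when the set \<open>range x\<close> is.\<close>

definition W_bounded :: "('a \<Rightarrow> real) \<Rightarrow> 'a set \<Rightarrow> bool"
  where "W_bounded W S \<longleftrightarrow> (\<exists>k. \<forall>x\<in>S. \<bar>W x\<bar> \<le> k)"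

text \<open>The limit inferior is taken in the extended reals, since it may be infinite.\<close>

definition W_subseq_weakly_lsc ::
    "'a::real_normed_vector set \<Rightarrow> ('a \<Rightarrow> real) \<Rightarrow> ('a \<Rightarrow> real) \<Rightarrow> bool"
  where "W_subseq_weakly_lsc D W J \<longleftrightarrow>
    (\<forall>x l. range x \<subseteq> D \<longrightarrow> W_bounded W (range x) \<longrightarrow> l \<in> D \<longrightarrow> weakly_converges x l \<longrightarrow>
      (\<exists>r :: nat \<Rightarrow> nat. strict_mono r \<and> ereal (J l) \<le> liminf (\<lambda>j. ereal (J (x (r j))))))"

definition W_coercive :: "'a set \<Rightarrow> ('a \<Rightarrow> real) \<Rightarrow> (nat \<Rightarrow> 'a \<Rightarrow> real) \<Rightarrow> bool"
  where "W_coercive D W Jn \<longleftrightarrow>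
    (\<forall>x. range x \<subseteq> D \<longrightarrow> filterlim (\<lambda>n. W (x n)) at_top sequentially \<longrightarrow>
      filterlim (\<lambda>n. Jn n (x n)) at_top sequentially)"

definition W_uniformly_consistent ::
    "'a set \<Rightarrow> ('a \<Rightarrow> real) \<Rightarrow> (nat \<Rightarrow> 'a \<Rightarrow> real) \<Rightarrow> ('a \<Rightarrow> real) \<Rightarrow> bool"
  where "W_uniformly_consistent D W Jn J \<longleftrightarrow>
    (\<forall>c>0. \<forall>\<epsilon>>0. \<exists>N. \<forall>n\<ge>N. \<forall>x\<in>D. \<bar>W x\<bar> \<le> c \<longrightarrow> \<bar>Jn n x - J x\<bar> < \<epsilon>)"

end

theory Submission
  imports Defs
begin

text \<open>
  This is the direct method of the calculus of variations, run along subsequences. Minimality gives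
  \<open>Jn n (x n) \<le> Jn n xbar\<close>, and the right-hand side converges to \<open>J xbar\<close> by consistency at the
  single point \<open>xbar\<close>. So the minimal values cannot tend to infinity along any subsequence, and
  coercivity makes the minimizers \<open>W\<close>-bounded (lemma \<open>coercive_sublevel_W_bounded\<close>).

  On a \<open>W\<close>-bounded set \<open>Jn n\<close> is uniformly close to \<open>J\<close>, so the minimizers form a minimizing
  sequence for \<open>J\<close>: eventually \<open>J (x n) < J xbar + \<epsilon>\<close>. Every subsequence has, by weak compactness, a
  further subsequence with a weak limit in \<open>D\<close>, and lower semicontinuity shows that this limit
  minimizes \<open>J\<close>; by uniqueness it is \<open>xbar\<close>. Since every subsequence has a further subsequence
  converging to the same limit \<open>xbar\<close>, the whole sequence does (lemma
  \<open>weakly_converges_if_subseqs\<close>).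
\<close>

text \<open>
  Coercivity speaks of full sequences \<open>Jn n (y n)\<close> only. A sequence \<open>z\<close> paired with the functionals
  at the times \<open>s k\<close> is spread out to a full sequence: the gaps between these times are filled with
  terms of \<open>z\<close> itself, so that \<open>W\<close> still tends to infinity.
\<close>

lemma W_coercive_subseq:
  fixes s :: "nat \<Rightarrow> nat"
  assumes "W_coercive D W Jn" "strict_mono s" "range z \<subseteq> D"
    and lim: "filterlim (\<lambda>k. W (z k)) at_top sequentially"
  shows "filterlim (\<lambda>k. Jn (s k) (z k)) at_top sequentially"
proof -
  define y where "y n = z (if n \<in> range s then inv s n else n)" for n
  have inj: "inj s"
    using \<open>strict_mono s\<close> by (rule strict_mono_imp_inj_on)
  have ys: "y (s k) = z k" for k
    by (simp add: y_def inv_f_f[OF inj])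
  have idx: "filterlim (\<lambda>n. if n \<in> range s then inv s n else n) at_top sequentially"
    unfolding filterlim_at_top
  proof
    fix K :: nat
    have "K \<le> (if n \<in> range s then inv s n else n)" if "n \<ge> s K" for n
    proof (cases "n \<in> range s")
      case True
      then obtain k where "n = s k" by blast
      then show ?thesis
        using that strict_mono_less_eq[OF \<open>strict_mono s\<close>] by (simp add: inv_f_f[OF inj])
    next
      case False
      then show ?thesis
        using that strict_mono_imp_increasing[OF \<open>strict_mono s\<close>, of K] by simp
    qed
    then show "\<forall>\<^sub>F n in sequentially. K \<le> (if n \<in> range s then inv s n else n)"
      using eventually_sequentially by blast
  qed
  have "filterlim (\<lambda>n. W (y n)) at_top sequentially"
    unfolding y_def by (rule filterlim_compose[OF lim idx])
  moreover have "range y \<subseteq> D"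
    using \<open>range z \<subseteq> D\<close> by (auto simp: y_def)
  ultimately have "filterlim (\<lambda>n. Jn n (y n)) at_top sequentially"
    using \<open>W_coercive D W Jn\<close> by (auto simp: W_coercive_def)
  then have "filterlim (\<lambda>k. Jn (s k) (y (s k))) at_top sequentially"
    by (rule filterlim_compose[OF _ filterlim_subseq[OF \<open>strict_mono s\<close>]])
  then show ?thesis
    by (simp add: ys)
qed

lemma subseq_at_top_if_unbounded:
  fixes a :: "nat \<Rightarrow> real"
  assumes unbounded: "\<not> (\<exists>c. \<forall>n. a n \<le> c)"
  obtains s :: "nat \<Rightarrow> nat" where "strict_mono s" "filterlim (\<lambda>k. a (s k)) at_top sequentially"
proof -
  have later: "\<exists>n>m. a n > c" for m c
  proof -
    \<comment> \<open>A value above all of \<open>a 0, \<dots>, a m\<close> can only occur after \<open>m\<close>.\<close>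
    obtain n where n: "a n > Max (insert c (a ` {..m}))"
      using unbounded by (meson not_le)
    then have "a n > c" "\<forall>i\<le>m. a i < a n"
      by auto
    then show ?thesis
      by (metis less_irrefl not_le)
  qed
  have "\<exists>s. \<forall>k. a (s k) > real k \<and> s k < s (Suc k)"
    by (rule dependent_nat_choice) (use later in blast)+
  then obtain s where s: "\<And>k. a (s k) > real k" "\<And>k. s k < s (Suc k)"
    by blast
  have "filterlim (\<lambda>k. a (s k)) at_top sequentially"
    by (rule filterlim_at_top_mono[OF filterlim_real_sequentially])
      (use s(1) in \<open>simp add: less_imp_le\<close>)
  moreover have "strict_mono s"
    using s(2) by (simp add: strict_mono_Suc_iff)
  ultimately show thesis
    using that by blast
qed

text \<open>
  Otherwise \<open>W\<close> would tend to infinity along some subsequence, and so would \<open>Jn n (x n)\<close>.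
\<close>

lemma coercive_sublevel_W_bounded:
  assumes coercive: "W_coercive D W Jn" and "range x \<subseteq> D"
    and below: "\<And>y. y \<in> D \<Longrightarrow> W y \<ge> - \<gamma>"
    and sublevel: "\<forall>\<^sub>F n in sequentially. Jn n (x n) \<le> C"
  shows "W_bounded W (range x)"
proof -
  have "\<exists>c. \<forall>n. W (x n) \<le> c"
  proof (rule ccontr)
    assume "\<not> (\<exists>c. \<forall>n. W (x n) \<le> c)"
    then obtain s :: "nat \<Rightarrow> nat"
      where s: "strict_mono s" and lim: "filterlim (\<lambda>k. W (x (s k))) at_top sequentially"
      using subseq_at_top_if_unbounded[of "\<lambda>n. W (x n)"] by blast
    have "filterlim (\<lambda>k. Jn (s k) (x (s k))) at_top sequentially"
      by (rule W_coercive_subseq[OF coercive s _ lim]) (use \<open>range x \<subseteq> D\<close> in auto)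
    then have "\<forall>\<^sub>F k in sequentially. Jn (s k) (x (s k)) > C"
      by (simp add: filterlim_at_top_dense)
    moreover have "\<forall>\<^sub>F k in sequentially. Jn (s k) (x (s k)) \<le> C"
      using s sublevel by (rule eventually_subseq)
    ultimately have "\<forall>\<^sub>F k in sequentially. False"
      by eventually_elim simp
    then show False
      by simp
  qed
  then obtain c where c: "\<And>n. W (x n) \<le> c"
    by blast
  have "\<bar>W (x n)\<bar> \<le> max \<gamma> c" for n
  proof -
    have "x n \<in> D"
      using \<open>range x \<subseteq> D\<close> by auto
    then show ?thesis
      using c[of n] below[of "x n"] by linarith
  qed
  then show ?thesis
    by (auto simp: W_bounded_def)
qed

lemma W_uniformly_consistent_on_bounded:
  assumes "W_uniformly_consistent D W Jn J" "S \<subseteq> D" "W_bounded W S" "\<epsilon> > 0"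
  shows "\<forall>\<^sub>F n in sequentially. \<forall>y\<in>S. \<bar>Jn n y - J y\<bar> < \<epsilon>"
proof -
  obtain k where k: "\<And>y. y \<in> S \<Longrightarrow> \<bar>W y\<bar> \<le> k"
    using \<open>W_bounded W S\<close> by (auto simp: W_bounded_def)
  \<comment> \<open>Consistency is stated for positive bounds, while \<open>k\<close> may be \<open>0\<close>.\<close>
  have "max 1 k > 0"
    by simp
  then obtain N where N: "\<And>n y. n \<ge> N \<Longrightarrow> y \<in> D \<Longrightarrow> \<bar>W y\<bar> \<le> max 1 k \<Longrightarrow> \<bar>Jn n y - J y\<bar> < \<epsilon>"
    using assms(1) \<open>\<epsilon> > 0\<close> unfolding W_uniformly_consistent_def by meson
  have "\<forall>y\<in>S. \<bar>Jn n y - J y\<bar> < \<epsilon>" if "n \<ge> N" for n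
  proof
    fix y assume "y \<in> S"
    then show "\<bar>Jn n y - J y\<bar> < \<epsilon>"
      using N[OF that] k \<open>S \<subseteq> D\<close> by (meson max.coboundedI2 subsetD)
  qed
  then show ?thesis
    using eventually_sequentially by blast
qed

lemma W_bounded_subset: "W_bounded W S \<Longrightarrow> T \<subseteq> S \<Longrightarrow> W_bounded W T"
  unfolding W_bounded_def by (meson subsetD)

text \<open>
  Semicontinuity along an unspecified subsequence is enough here, because an eventual upper bound
  on \<open>J (y n)\<close> passes to every subsequence.
\<close>

lemma W_subseq_weakly_lsc_le:
  assumes "W_subseq_weakly_lsc D W J" "range y \<subseteq> D" "W_bounded W (range y)" "l \<in> D"
    and "weakly_converges y l"
    and upper: "\<And>\<epsilon>. \<epsilon> > 0 \<Longrightarrow> \<forall>\<^sub>F n in sequentially. J (y n) \<le> m + \<epsilon>"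
  shows "J l \<le> m"
proof (rule field_le_epsilon)
  fix \<epsilon> :: real assume "\<epsilon> > 0"
  obtain r :: "nat \<Rightarrow> nat"
    where r: "strict_mono r" and le: "ereal (J l) \<le> liminf (\<lambda>j. ereal (J (y (r j))))"
    using assms(1-5) unfolding W_subseq_weakly_lsc_def by blast
  have "\<forall>\<^sub>F j in sequentially. ereal (J (y (r j))) \<le> ereal (m + \<epsilon>)"
    using eventually_subseq[OF r upper[OF \<open>\<epsilon> > 0\<close>]] by simp
  then have "liminf (\<lambda>j. ereal (J (y (r j)))) \<le> liminf (\<lambda>j::nat. ereal (m + \<epsilon>))"
    by (rule Liminf_mono)
  also have "\<dots> = ereal (m + \<epsilon>)"
    by (simp add: Liminf_const)
  finally show "J l \<le> m + \<epsilon>"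
    using le by (metis ereal_less_eq(3) order_trans)
qed

text \<open>
  For each continuous functional this is the subsequence criterion for real sequences: if the
  values \<open>f (x n)\<close> stay away from \<open>f l\<close> for infinitely many \<open>n\<close>, these \<open>n\<close> form a subsequence
  without a further subsequence weakly converging to \<open>l\<close>.
\<close>

lemma weakly_converges_if_subseqs:
  assumes subseqs: "\<And>s :: nat \<Rightarrow> nat. strict_mono s \<Longrightarrow>
    \<exists>r :: nat \<Rightarrow> nat. strict_mono r \<and> weakly_converges (x \<circ> s \<circ> r) l"
  shows "weakly_converges x l"
  unfolding weakly_converges_def
proof (intro allI impI)
  fix f :: "'a \<Rightarrow> real" assume f: "bounded_linear f"
  show "(\<lambda>n. f (x n)) \<longlonglongrightarrow> f l"
  proof (rule ccontr)
    assume "\<not> (\<lambda>n. f (x n)) \<longlonglongrightarrow> f l"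
    then obtain e where "e > 0" and "\<not> (\<forall>\<^sub>F n in sequentially. dist (f (x n)) (f l) < e)"
      by (auto simp: tendsto_iff)
    then have "\<exists>\<^sub>\<infinity>n. dist (f (x n)) (f l) \<ge> e"
      by (simp add: frequently_def cofinite_eq_sequentially not_le)
    then have inf: "infinite {n. dist (f (x n)) (f l) \<ge> e}"
      by (simp add: INFM_iff_infinite)
    define s where "s = enumerate {n. dist (f (x n)) (f l) \<ge> e}"
    have s: "strict_mono s"
      unfolding s_def using inf by (rule strict_mono_enumerate)
    have far: "dist (f (x (s k))) (f l) \<ge> e" for k
      using enumerate_in_set[OF inf, of k] by (simp add: s_def)
    obtain r :: "nat \<Rightarrow> nat" where "weakly_converges (x \<circ> s \<circ> r) l"
      using subseqs[OF s] by blast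
    then have "(\<lambda>k. f (x (s (r k)))) \<longlonglongrightarrow> f l"
      using f by (auto simp: weakly_converges_def)
    then have "\<forall>\<^sub>F k in sequentially. dist (f (x (s (r k)))) (f l) < e"
      using \<open>e > 0\<close> by (rule tendstoD)
    then have "\<forall>\<^sub>F k :: nat in sequentially. False"
      by eventually_elim (use far in \<open>simp add: not_less [symmetric]\<close>)
    then show False
      by simp
  qed
qed

theorem theorem3p3:
  fixes D :: "'a::real_normed_vector set"
    and W J :: "'a \<Rightarrow> real"
    and Jn :: "nat \<Rightarrow> 'a \<Rightarrow> real"
    and xbar :: 'a
    and x :: "nat \<Rightarrow> 'a"
  assumes W_below: "\<exists>\<gamma>\<ge>0. \<forall>y\<in>D. W y \<ge> - \<gamma>"
    and W_compact: "\<And>y. range y \<subseteq> D \<Longrightarrow> W_bounded W (range y) \<Longrightarrow>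
      \<exists>(r :: nat \<Rightarrow> nat) l. strict_mono r \<and> l \<in> D \<and> weakly_converges (y \<circ> r) l"
    and lsc: "W_subseq_weakly_lsc D W J"
    and coercive: "W_coercive D W Jn"
    and consistent: "W_uniformly_consistent D W Jn J"
    and xbar_min: "is_arg_min J (\<lambda>y. y \<in> D) xbar"
    and xbar_unique: "\<And>y. is_arg_min J (\<lambda>z. z \<in> D) y \<Longrightarrow> y = xbar"
    and x_min: "\<And>n. is_arg_min (Jn n) (\<lambda>y. y \<in> D) (x n)"
  shows "weakly_converges x xbar"
proof -
  have xbar: "xbar \<in> D" and xbar_le: "\<And>y. y \<in> D \<Longrightarrow> J xbar \<le> J y"
    using xbar_min by (auto simp: is_arg_min_linorder)
  have xD: "range x \<subseteq> D" and x_le: "\<And>n. Jn n (x n) \<le> Jn n xbar"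
    using x_min xbar by (auto simp: is_arg_min_linorder)
  obtain \<gamma> where below: "\<And>y. y \<in> D \<Longrightarrow> W y \<ge> - \<gamma>"
    using W_below by blast
  have at_xbar: "\<forall>\<^sub>F n in sequentially. \<bar>Jn n xbar - J xbar\<bar> < \<epsilon>" if "\<epsilon> > 0" for \<epsilon>
    using W_uniformly_consistent_on_bounded[OF consistent, of "{xbar}"] xbar that
    by (auto simp: W_bounded_def)
  have "\<forall>\<^sub>F n in sequentially. Jn n (x n) \<le> J xbar + 1"
    using at_xbar[OF zero_less_one] by eventually_elim (use x_le in \<open>smt (verit)\<close>)
  then have bdd: "W_bounded W (range x)"
    using coercive_sublevel_W_bounded[OF coercive xD below] by blast
  have minimizing: "\<forall>\<^sub>F n in sequentially. J (x n) \<le> J xbar + \<epsilon>" if "\<epsilon> > 0" for \<epsilon>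
  proof -
    have half: "\<epsilon> / 2 > 0"
      using that by simp
    show ?thesis
      using W_uniformly_consistent_on_bounded[OF consistent xD bdd half] at_xbar[OF half]
    proof eventually_elim
      case (elim n)
      have "\<bar>Jn n (x n) - J (x n)\<bar> < \<epsilon> / 2"
        using elim(1) by blast
      then show ?case
        using elim(2) x_le[of n] by linarith
    qed
  qed
  show ?thesis
  proof (rule weakly_converges_if_subseqs)
    fix s :: "nat \<Rightarrow> nat" assume s: "strict_mono s"
    have "range (x \<circ> s) \<subseteq> D"
      using xD by auto
    moreover have "W_bounded W (range (x \<circ> s))"
      by (rule W_bounded_subset[OF bdd]) auto
    ultimately obtain r :: "nat \<Rightarrow> nat" and l
      where r: "strict_mono r" and l: "l \<in> D" and conv: "weakly_converges (x \<circ> s \<circ> r) l"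
      using W_compact by blast
    have "J l \<le> J xbar"
    proof (rule W_subseq_weakly_lsc_le[OF lsc _ _ l conv])
      show "range (x \<circ> s \<circ> r) \<subseteq> D"
        using xD by auto
      show "W_bounded W (range (x \<circ> s \<circ> r))"
        by (rule W_bounded_subset[OF bdd]) auto
      show "\<forall>\<^sub>F n in sequentially. J ((x \<circ> s \<circ> r) n) \<le> J xbar + \<epsilon>" if "\<epsilon> > 0" for \<epsilon>
        using eventually_subseq[OF r eventually_subseq[OF s minimizing[OF that]]] by simp
    qed
    then have "is_arg_min J (\<lambda>z. z \<in> D) l"
      using l xbar_le by (auto simp: is_arg_min_linorder intro: order_trans)
    then have "l = xbar"
      by (rule xbar_unique)
    then show "\<exists>r :: nat \<Rightarrow> nat. strict_mono r \<and> weakly_converges (x \<circ> s \<circ> r) xbar"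
      using r conv by blast
  qed
qed

end
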